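(* Let $M\in\mathbb{R}^{n\times n}$ have rank $r$, let $\Omega\subseteq\{1,\dots,n\}\times\{1,\dots,n\}$, and assume $$T_{\mathcal{A}_\Omega}(M)\cap T_{\mathcal{M}_r}(M)=\{0\}.$$ Then the alternating projection iteration $X_{k+1}=P_{\mathcal{A}_\Omega}(P_{\mathcal{M}_r}(X_k))$ converges to $M$ locally at a linear rate: there exists a neighborhood $V$ of $M$ in $\mathbb{R}^{n\times n}$ such that if $X_0\in V$, then there exists a positive constant $c<1$ such that $$\|X_k-M\|\le c^k\,\|X_0-M\|\qquad\text{for all }k\ge 0 .$$
   Context: $\mathcal{M}_r\subset\mathbb{R}^{n\times n}$ is the smooth manifold of $n\times n$ real matrices of rank exactly $r$. $\mathcal{A}_\Omega=\{X\in\mathbb{R}^{n\times n}: X_{ij}=M_{ij}\ \text{for all }(i,j)\in\Omega\}$ is the affine space of matrices agreeing with $M$ on $\Omega$. $T_{\mathcal{M}_r}(M)$ and $T_{\mathcal{A}_\Omega}(M)$ are the tangent spaces at $M$, viewed as linear subspaces of $\mathbb{R}^{n\times n}$; explicitly $T_{\mathcal{A}_\Omega}(M)=\{X: X_{ij}=0\ \forall (i,j)\in\Omega\}$ and $T_{\mathcal{M}_r}(M)=\{XM+MY: X,Y\in\mathbb{R}^{n\times n}\}$. $P_{\mathcal{M}_r}$ is the (Frobenius-)nearest-point projection onto $\mathcal{M}_r$, computed by truncating the singular value decomposition to the $r$ largest singular values (it is single-valued near $M$). $P_{\mathcal{A}_\Omega}$ is the orthogonal projection onto $\mathcal{A}_\Omega$,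 i.e. it replaces the entries at positions in $\Omega$ by those of $M$. $\|\cdot\|$ is the Frobenius norm. *)

theory Defs
  imports "HOL-Analysis.Analysis"
begin

section \<open>The sets, their tangent spaces, and the projections\<close>

definition fixed_rank_set :: "nat \<Rightarrow> (real^'n^'n) set" where
  "fixed_rank_set r = {A. rank A = r}"

definition completion_set :: "real^'n^'n \<Rightarrow> ('n \<times> 'n) set \<Rightarrow> (real^'n^'n) set" where
  "completion_set M \<Omega> = {A. \<forall>(i, j)\<in>\<Omega>. A $ i $ j = M $ i $ j}"

text \<open>
  The tangent space of an embedded submanifold at one of its points, as a linear subspace of
  the ambient space: the velocities of differentiable curves in the set through the point. The
  lemmas \<open>tangent_space_completion_set\<close> and \<open>tangent_space_fixed_rank_set\<close> below give the
  explicit form of the two instances.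
\<close>

definition tangent_space :: "'a::real_normed_vector set \<Rightarrow> 'a \<Rightarrow> 'a set" where
  "tangent_space S x =
     {v. \<exists>\<gamma> e. e > 0 \<and> (\<forall>t. \<bar>t\<bar> < e \<longrightarrow> \<gamma> t \<in> S) \<and> \<gamma> 0 = x \<and>
           (\<gamma> has_vector_derivative v) (at (0::real))}"

text \<open>
  The norm on \<^typ>\<open>real^'n^'n\<close> is the Frobenius norm (\<open>norm_matrix_frobenius\<close>), so
  \<^const>\<open>closest_point\<close> is the Frobenius-nearest-point projection. It is a choice among the
  nearest points, hence unspecified where none exists; for \<^const>\<open>fixed_rank_set\<close>, which
  need not be closed, this does not happen near a matrix of rank \<open>r\<close>.
\<close>

definition proj_fixed_rank :: "nat \<Rightarrow> real^'n^'n \<Rightarrow> real^'n^'n" where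
  "proj_fixed_rank r = closest_point (fixed_rank_set r)"

definition proj_completion :: "real^'n^'n \<Rightarrow> ('n \<times> 'n) set \<Rightarrow> real^'n^'n \<Rightarrow> real^'n^'n" where
  "proj_completion M \<Omega> = closest_point (completion_set M \<Omega>)"


section \<open>Agreement with the explicit descriptions\<close>

lemma norm_matrix_frobenius:
  fixes A :: "real^'n^'m"
  shows "norm A = sqrt (\<Sum>i\<in>UNIV. \<Sum>j\<in>UNIV. (A $ i $ j)\<^sup>2)"
  by (simp add: norm_vec_def L2_set_def sum_nonneg)

lemma proj_completion_nth:
  fixes M X :: "real^'n^'n"
  shows "proj_completion M \<Omega> X = (\<chi> i j. if (i, j) \<in> \<Omega> then M $ i $ j else X $ i $ j)"
    (is "_ = ?Y")
proof -
  let ?C = "completion_set M \<Omega>"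
  have Y: "?Y \<in> ?C"
    by (auto simp: completion_set_def)
  have C: "?C = (\<Inter>p\<in>\<Omega>. {A. A $ fst p $ snd p = M $ fst p $ snd p})"
    by (fastforce simp: completion_set_def)
  have closed: "closed ?C"
    unfolding C by (intro closed_INT ballI closed_Collect_eq continuous_intros)
  have convex: "convex ?C"
    unfolding convex_def
    by (auto simp: completion_set_def case_prod_unfold simp flip: distrib_right)
  have le: "\<forall>Z\<in>?C. dist X ?Y \<le> dist X Z"
  proof
    fix Z assume "Z \<in> ?C"
    then show "dist X ?Y \<le> dist X Z"
      unfolding dist_norm norm_matrix_frobenius
      by (intro real_sqrt_le_mono sum_mono) (auto simp: completion_set_def)
  qed
  show ?thesis
    unfolding proj_completion_def
    by (rule closest_point_unique[OF convex closed Y le, symmetric])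
qed

lemma tangent_space_completion_set:
  fixes M :: "real^'n^'n"
  shows "tangent_space (completion_set M \<Omega>) M = {X. \<forall>(i, j)\<in>\<Omega>. X $ i $ j = 0}"
proof (intro equalityI subsetI)
  fix X assume "X \<in> tangent_space (completion_set M \<Omega>) M"
  then obtain \<gamma> e where g: "e > 0" "\<And>t. \<bar>t\<bar> < e \<Longrightarrow> \<gamma> t \<in> completion_set M \<Omega>"
    "(\<gamma> has_vector_derivative X) (at (0::real))"
    by (auto simp: tangent_space_def)
  have "X $ i $ j = 0" if ij: "(i, j) \<in> \<Omega>" for i j
  proof -
    have "bounded_linear (\<lambda>A::real^'n^'n. A $ i $ j)"
      using bounded_linear_compose[OF bounded_linear_vec_nth bounded_linear_vec_nth] .
    then have "((\<lambda>t. \<gamma> t $ i $ j) has_vector_derivative X $ i $ j) (at 0)"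
      using bounded_linear.has_vector_derivative g(3) by blast
    moreover have "((\<lambda>t. \<gamma> t $ i $ j) has_vector_derivative 0) (at 0)"
    proof (rule has_vector_derivative_transform_within_open)
      show "((\<lambda>t. M $ i $ j) has_vector_derivative 0) (at 0)"
        by simp
      show "open {-e<..<e}" "0 \<in> {-e<..<e}"
        using g(1) by auto
      show "M $ i $ j = \<gamma> t $ i $ j" if "t \<in> {-e<..<e}" for t
        using g(2)[of t] that ij by (force simp: completion_set_def)
    qed
    ultimately show ?thesis
      by (rule vector_derivative_unique_at)
  qed
  then show "X \<in> {X. \<forall>(i, j)\<in>\<Omega>. X $ i $ j = 0}"
    by auto
next
  fix X :: "real^'n^'n" assume X: "X \<in> {X. \<forall>(i, j)\<in>\<Omega>. X $ i $ j = 0}"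
  have "((\<lambda>t. M + t *\<^sub>R X) has_vector_derivative X) (at 0)"
    by (auto intro!: derivative_eq_intros)
  moreover have "M + t *\<^sub>R X \<in> completion_set M \<Omega>" for t
    using X by (auto simp: completion_set_def)
  ultimately show "X \<in> tangent_space (completion_set M \<Omega>) M"
    unfolding tangent_space_def
    by (intro CollectI exI[of _ "\<lambda>t. M + t *\<^sub>R X"] exI[of _ 1]) auto
qed

lemma rank_lower_semicontinuous:
  fixes A :: "real^'n^'m"
  assumes "(f \<longlongrightarrow> A) F"
  shows "\<forall>\<^sub>F x in F. rank A \<le> rank (f x)"
proof -
  obtain g where g: "linear g" "\<And>v. v \<in> range ((*v) A) \<Longrightarrow> A *v g v = v"
    using linear_exists_right_inverse_on[OF matrix_vector_mul_linear[of A] subspace_UNIV] by auto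
  define S where "S = g ` range ((*v) A)"
  have sub: "subspace (range ((*v) A))"
    by (intro linear_subspace_image matrix_vector_mul_linear subspace_UNIV)
  have S: "subspace S"
    unfolding S_def using g(1) sub by (rule linear_subspace_image)
  have AS: "range ((*v) A) \<subseteq> (*v) A ` S"
    unfolding S_def using g(2) by (force simp: image_iff)
  have inj: "\<forall>x\<in>S. A *v x = 0 \<longrightarrow> x = 0"
    unfolding S_def using g(2) linear_0[OF g(1)] by auto
  obtain e where e: "e > 0" "\<And>x. x \<in> S \<Longrightarrow> e * norm x \<le> norm (A *v x)"
    using injective_imp_isometric[OF closed_subspace[OF S] S _ inj] matrix_vector_mul_bounded_linear
    by blast
  let ?s = "\<lambda>B::real^'n^'m. \<Sum>i\<in>UNIV. \<Sum>j\<in>UNIV. \<bar>B $ i $ j\<bar>"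
  have "((\<lambda>x. ?s (f x - A)) \<longlongrightarrow> ?s (A - A)) F"
    by (intro tendsto_intros assms)
  then have "\<forall>\<^sub>F x in F. ?s (f x - A) < e"
    by (rule order_tendstoD(2)) (use e in simp)
  then show ?thesis
  proof eventually_elim
    case (elim x)
    have "y = 0" if y: "y \<in> S" "f x *v y = 0" for y
    proof (rule ccontr)
      assume "y \<noteq> 0"
      have "e * norm y \<le> norm (A *v y)"
        using e(2) y(1) .
      also have "\<dots> = norm ((f x - A) *v y)"
        using y(2) by (simp add: matrix_vector_mult_diff_rdistrib)
      also have "\<dots> \<le> onorm ((*v) (f x - A)) * norm y"
        by (rule onorm) (rule matrix_vector_mul_bounded_linear)
      also have "\<dots> \<le> ?s (f x - A) * norm y"
        by (intro mult_right_mono onorm_le_matrix_component_sum) auto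
      also have "\<dots> < e * norm y"
        using elim \<open>y \<noteq> 0\<close> by simp
      finally show False by simp
    qed
    then have inj: "inj_on ((*v) (f x)) (span S)"
      unfolding span_eq_iff[THEN iffD2, OF S]
      using linear_injective_on_subspace_0[OF matrix_vector_mul_linear S] by blast
    have "rank A \<le> dim ((*v) A ` S)"
      unfolding rank_dim_range by (rule dim_subset[OF AS])
    also have "\<dots> \<le> dim S"
      by (intro dim_image_le matrix_vector_mul_linear)
    also have "\<dots> = dim ((*v) (f x) ` S)"
      by (rule dim_image_eq[OF matrix_vector_mul_linear inj, symmetric])
    also have "\<dots> \<le> rank (f x)"
      unfolding rank_dim_range by (rule dim_subset) auto
    finally show ?case .
  qed
qed

lemma fixed_rank_velocity_kernel:
  fixes M :: "real^'n^'m"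
  assumes rk: "\<forall>\<^sub>F t in at (0::real). rank (\<gamma> t) = rank M"
    and "\<gamma> 0 = M" and der: "(\<gamma> has_vector_derivative V) (at 0)"
    and u: "M *v u = 0"
  shows "V *v u \<in> range ((*v) M)"
proof (cases "u = 0")
  case True
  then show ?thesis by (metis matrix_vector_mult_0_right rangeI)
next
  case False
  define U :: "real^'n^'n" where "U = (\<chi> i j. u $ i * u $ j)"
  have U: "U *v x = (u \<bullet> x) *\<^sub>R u" for x
    by (simp add: U_def vec_eq_iff matrix_vector_mult_def inner_vec_def sum_distrib_left mult_ac)
  let ?N = "M + V ** U"
  let ?h = "\<lambda>t. \<gamma> t + ((1 / t) *\<^sub>R (\<gamma> t - M)) ** U"
  have lim_quot: "((\<lambda>t. (1 / t) *\<^sub>R (\<gamma> t - M)) \<longlongrightarrow> V) (at 0)"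
  proof (rule Lim_transform_eventually)
    have "((\<lambda>t. (1 / \<bar>t\<bar>) *\<^sub>R (\<gamma> t - (M + t *\<^sub>R V))) \<longlongrightarrow> 0) (at 0)"
      using der \<open>\<gamma> 0 = M\<close> by (simp add: has_vector_derivative_def has_derivative_within)
    then have "((\<lambda>t. norm ((1 / \<bar>t\<bar>) *\<^sub>R (\<gamma> t - (M + t *\<^sub>R V)))) \<longlongrightarrow> 0) (at 0)"
      by (rule tendsto_norm_zero)
    then have "((\<lambda>t. norm ((1 / t) *\<^sub>R (\<gamma> t - M - t *\<^sub>R V))) \<longlongrightarrow> 0) (at 0)"
      by (simp add: diff_diff_eq)
    then have "((\<lambda>t. V + (1 / t) *\<^sub>R (\<gamma> t - M - t *\<^sub>R V)) \<longlongrightarrow> V + 0) (at 0)"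
      by (intro tendsto_add tendsto_const) (rule tendsto_norm_zero_cancel)
    then show "((\<lambda>t. V + (1 / t) *\<^sub>R (\<gamma> t - M - t *\<^sub>R V)) \<longlongrightarrow> V) (at 0)"
      by simp
    show "\<forall>\<^sub>F t in at 0. V + (1 / t) *\<^sub>R (\<gamma> t - M - t *\<^sub>R V) = (1 / t) *\<^sub>R (\<gamma> t - M)"
      using eventually_neq_at_within[of 0]
      by (rule eventually_mono) (simp add: scaleR_diff_right)
  qed
  have lim_g: "(\<gamma> \<longlongrightarrow> M) (at 0)"
    using has_vector_derivative_continuous[OF der] \<open>\<gamma> 0 = M\<close> by (auto simp: continuous_at isCont_def)
  have "((\<lambda>t. B t ** U) \<longlongrightarrow> V ** U) (at 0)" if "(B \<longlongrightarrow> V) (at 0)" for B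
    unfolding matrix_matrix_mult_def
    by (intro vec_tendstoI) (auto intro!: tendsto_intros that)
  then have "(?h \<longlongrightarrow> ?N) (at 0)"
    by (intro tendsto_add lim_g) (use lim_quot in blast)
  then have "\<forall>\<^sub>F t in at 0. rank ?N \<le> rank (?h t)"
    by (rule rank_lower_semicontinuous)
  then have "\<forall>\<^sub>F t in at 0. rank ?N \<le> rank (?h t) \<and> rank (\<gamma> t) = rank M"
    using rk by (rule eventually_conj)
  then obtain t where t: "rank ?N \<le> rank (?h t)" "rank (\<gamma> t) = rank M"
    using eventually_happens'[OF trivial_limit_at] by blast
  have "?h t = \<gamma> t ** (mat 1 + (1 / t) *\<^sub>R U)"
    by (simp add: matrix_eq matrix_vector_mult_add_rdistrib matrix_vector_mult_diff_rdistrib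
        matrix_vector_right_distrib matrix_vector_mult_scaleR U u scaleR_diff_right
        flip: matrix_vector_mul_assoc scaleR_matrix_vector_assoc)
  then have rkN: "rank ?N \<le> rank M"
    using t rank_mul_le_left[of "\<gamma> t" "mat 1 + (1 / t) *\<^sub>R U"] by simp
  have N: "?N *v x = M *v x + (u \<bullet> x) *\<^sub>R (V *v u)" for x
    by (simp add: matrix_vector_mult_add_rdistrib U matrix_vector_mult_scaleR
        flip: matrix_vector_mul_assoc)
  have "M *v x \<in> range ((*v) ?N)" for x
  proof -
    have "M *v x = ?N *v (x - ((u \<bullet> x) / (u \<bullet> u)) *\<^sub>R u)"
      using False unfolding N
      by (simp add: matrix_vector_mult_diff_distrib matrix_vector_mult_scaleR u inner_diff_right)
    then show ?thesis by blast
  qed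
  then have sub: "range ((*v) M) \<subseteq> range ((*v) ?N)"
    by blast
  have "?N *v ((1 / (u \<bullet> u)) *\<^sub>R u) = V *v u"
    using False unfolding N by (simp add: matrix_vector_mult_scaleR u)
  then have "V *v u \<in> range ((*v) ?N)"
    by (metis rangeI)
  moreover have "range ((*v) M) = range ((*v) ?N)"
    using sub rkN unfolding rank_dim_range
    by (intro subspace_dim_equal linear_subspace_image matrix_vector_mul_linear subspace_UNIV)
  ultimately show ?thesis by simp
qed

lemma tangent_space_fixed_rank_set:
  fixes M :: "real^'n^'n"
  assumes "rank M = r"
  shows "tangent_space (fixed_rank_set r) M = {X ** M + M ** Y | X Y. True}"
proof (intro equalityI subsetI)
  fix V assume "V \<in> tangent_space (fixed_rank_set r) M"
  then obtain \<gamma> e where g: "e > 0" "\<And>t. \<bar>t\<bar> < e \<Longrightarrow> rank (\<gamma> t) = r" "\<gamma> 0 = M"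
    "(\<gamma> has_vector_derivative V) (at (0::real))"
    by (auto simp: tangent_space_def fixed_rank_set_def)
  have rk: "\<forall>\<^sub>F t in at (0::real). rank (\<gamma> t) = rank M"
    unfolding eventually_at using g(1,2) assms by (auto simp: dist_real_def)
  have ker: "V *v u \<in> range ((*v) M)" if "M *v u = 0" for u
    using fixed_rank_velocity_kernel[OF rk g(3,4) that] .
  obtain g where g: "linear g" "\<And>v. v \<in> range ((*v) M) \<Longrightarrow> M *v g v = v"
    using linear_exists_right_inverse_on[OF matrix_vector_mul_linear[of M] subspace_UNIV] by auto
  define G where "G = matrix g"
  have G: "M *v (G *v v) = v" if "v \<in> range ((*v) M)" for v
    using g that by (simp add: G_def matrix_works)
  have "V = (V ** G) ** M + M ** (G ** V ** (mat 1 - G ** M))"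
  proof (subst matrix_eq, rule allI)
    fix x
    let ?u = "x - G *v (M *v x)"
    have "M *v ?u = 0"
      using G by (simp add: matrix_vector_mult_diff_distrib)
    then have "M *v (G *v (V *v ?u)) = V *v ?u"
      by (intro G ker)
    then show "V *v x = (V ** G ** M + M ** (G ** V ** (mat 1 - G ** M))) *v x"
      by (simp add: matrix_vector_mult_add_rdistrib matrix_vector_mult_diff_rdistrib
          matrix_vector_mult_diff_distrib flip: matrix_vector_mul_assoc)
  qed
  then show "V \<in> {X ** M + M ** Y | X Y. True}"
    by blast
next
  fix V assume "V \<in> {X ** M + M ** Y | X Y. True}"
  then obtain X Y where V: "V = X ** M + M ** Y"
    by blast
  define \<gamma> where "\<gamma> t = M + t *\<^sub>R V + (t * t) *\<^sub>R (X ** M ** Y)" for t :: real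
  have \<gamma>_eq: "\<gamma> t = (mat 1 + t *\<^sub>R X) ** M ** (mat 1 + t *\<^sub>R Y)" for t
    by (simp add: \<gamma>_def V matrix_eq matrix_vector_mult_add_rdistrib matrix_vector_right_distrib
        matrix_vector_mult_scaleR scaleR_add_right
        flip: matrix_vector_mul_assoc scaleR_matrix_vector_assoc)
  have "(\<gamma> has_vector_derivative V) (at 0)"
    unfolding \<gamma>_def by (auto intro!: derivative_eq_intros)
  moreover have "\<gamma> 0 = M"
    by (simp add: \<gamma>_def)
  moreover have "\<exists>e>0. \<forall>t. \<bar>t\<bar> < e \<longrightarrow> rank (\<gamma> t) = r"
  proof -
    have "(\<gamma> \<longlongrightarrow> M + 0 *\<^sub>R V + (0 * 0) *\<^sub>R (X ** M ** Y)) (nhds 0)"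
      unfolding \<gamma>_def by (intro tendsto_intros filterlim_ident)
    then have "\<forall>\<^sub>F t in nhds 0. rank M \<le> rank (\<gamma> t)"
      using rank_lower_semicontinuous by fastforce
    moreover have "rank (\<gamma> t) \<le> rank M" for t
      unfolding \<gamma>_eq using rank_mul_le_left rank_mul_le_right order_trans by blast
    ultimately show ?thesis
      unfolding eventually_nhds_metric using assms by (auto simp: dist_real_def intro: antisym)
  qed
  ultimately show "V \<in> tangent_space (fixed_rank_set r) M"
    unfolding tangent_space_def fixed_rank_set_def
    by blast
qed

end

theory Submission
  imports Defs
begin

text \<open>
  The iteration map contracts towards \<open>M\<close> near \<open>M\<close>. Otherwise there are \<open>X\<^sub>k \<rightarrow> M\<close> with nearest
  points \<open>p\<^sub>k\<close> of rank \<open>r\<close> such that the quotients \<open>(X\<^sub>k - M) / \<parallel>X\<^sub>k - M\<parallel>\<close> and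
  \<open>(p\<^sub>k - M) / \<parallel>X\<^sub>k - M\<parallel>\<close> converge, say to \<open>a\<close> and \<open>b\<close>, while the distance to \<open>M\<close> does not shrink
  in the limit. Semicontinuity of the rank puts \<open>b\<close> into the tangent space \<open>T\<close> at \<open>M\<close>, and
  \<open>X\<^sub>k - p\<^sub>k\<close> is normal to the tangent space at \<open>p\<^sub>k\<close>, so \<open>a - b\<close> is normal to \<open>T\<close>. Thus \<open>b\<close> is the
  orthogonal projection of the unit vector \<open>a\<close> to \<open>T\<close>, and its projection to the other tangent
  space still has norm at least \<open>1\<close>. This forces \<open>b\<close> into both tangent spaces, whence \<open>b = 0\<close>,
  a contradiction.
\<close>

text \<open>Along a curve in \<open>S\<close> through \<open>p\<close> with velocity
  \<open>v\<close>, the squared distance to \<open>x\<close> has a local minimum at time 0, where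
  its derivative is \<open>- 2 * ((x - p) \<bullet> v)\<close>.\<close>

lemma nearest_orthogonal_tangent:
  fixes p x :: "'a::real_inner"
  assumes near: "\<And>y. y \<in> S \<Longrightarrow> dist x p \<le> dist x y"
    and v: "v \<in> tangent_space S p"
  shows "(x - p) \<bullet> v = 0"
proof -
  obtain \<gamma> e where g: "e > 0" "\<And>t. \<bar>t\<bar> < e \<Longrightarrow> \<gamma> t \<in> S" "\<gamma> 0 = p"
    "(\<gamma> has_vector_derivative v) (at (0::real))"
    using v by (auto simp: tangent_space_def)
  let ?f = "\<lambda>t. (x - \<gamma> t) \<bullet> (x - \<gamma> t)"
  have "(?f has_derivative (\<lambda>t. (x - \<gamma> 0) \<bullet> (0 - t *\<^sub>R v) + (0 - t *\<^sub>R v) \<bullet> (x - \<gamma> 0))) (at 0)"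
    using g(4) unfolding has_vector_derivative_def
    by (intro has_derivative_inner has_derivative_diff has_derivative_const)
  then have "(?f has_derivative (*) (- 2 * ((x - p) \<bullet> v))) (at 0)"
    by (rule has_derivative_eq_rhs)
      (simp add: fun_eq_iff g(3) inner_commute algebra_simps)
  then have "DERIV ?f 0 :> - 2 * ((x - p) \<bullet> v)"
    by (simp add: has_field_derivative_def)
  moreover have "?f 0 \<le> ?f t" if "\<bar>0 - t\<bar> < e" for t
    using near[OF g(2)[of t]] that g(3)
    by (simp add: dist_norm norm_le)
  ultimately have "- 2 * ((x - p) \<bullet> v) = 0"
    using DERIV_local_min[of ?f _ 0 e] g(1) by blast
  then show ?thesis by simp
qed

text \<open>A version of \<open>fixed_rank_velocity_kernel\<close> for limits of scaled differences
  that need not lie on a curve. \<open>M + V ** U\<close> is a limit of matrices of rank at most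
  \<open>rank M\<close>, so by semicontinuity its rank is no larger. Its range contains that of
  \<open>M\<close>, hence equals it, and it also contains \<open>V *v u\<close>.\<close>

lemma fixed_rank_limit_direction_kernel:
  fixes M :: "real^'n^'m"
  assumes rk: "\<forall>\<^sub>F x in F. rank (p x) = rank M" and "F \<noteq> bot"
    and p: "(p \<longlongrightarrow> M) F"
    and quot: "((\<lambda>x. s x *\<^sub>R (p x - M)) \<longlongrightarrow> V) F"
    and u: "M *v u = 0"
  shows "V *v u \<in> range ((*v) M)"
proof (cases "u = 0")
  case True
  then show ?thesis by (metis matrix_vector_mult_0_right rangeI)
next
  case False
  define U :: "real^'n^'n" where "U = (\<chi> i j. u $ i * u $ j)"
  have U: "U *v x = (u \<bullet> x) *\<^sub>R u" for x
    by (simp add: U_def vec_eq_iff matrix_vector_mult_def inner_vec_def sum_distrib_left mult_ac)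
  let ?N = "M + V ** U"
  let ?h = "\<lambda>x. p x + (s x *\<^sub>R (p x - M)) ** U"
  have "((\<lambda>x. B x ** U) \<longlongrightarrow> V ** U) F" if "(B \<longlongrightarrow> V) F" for B
    unfolding matrix_matrix_mult_def
    by (intro vec_tendstoI) (auto intro!: tendsto_intros that)
  then have "(?h \<longlongrightarrow> ?N) F"
    by (intro tendsto_add p) (use quot in blast)
  then have "\<forall>\<^sub>F x in F. rank ?N \<le> rank (?h x) \<and> rank (p x) = rank M"
    by (intro eventually_conj rank_lower_semicontinuous rk)
  then obtain x where x: "rank ?N \<le> rank (?h x)" "rank (p x) = rank M"
    using eventually_happens'[OF \<open>F \<noteq> bot\<close>] by blast
  \<comment> \<open>Because \<open>M *v u = 0\<close>, the product \<open>M ** U\<close> vanishes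
    and \<open>p x\<close> factors out on the left.\<close>
  have "?h x = p x ** (mat 1 + s x *\<^sub>R U)"
    by (simp add: matrix_eq matrix_vector_mult_add_rdistrib matrix_vector_mult_diff_rdistrib
        matrix_vector_right_distrib matrix_vector_mult_scaleR U u scaleR_diff_right
        flip: matrix_vector_mul_assoc scaleR_matrix_vector_assoc)
  then have rkN: "rank ?N \<le> rank M"
    using x rank_mul_le_left[of "p x" "mat 1 + s x *\<^sub>R U"] by simp
  have N: "?N *v y = M *v y + (u \<bullet> y) *\<^sub>R (V *v u)" for y
    by (simp add: matrix_vector_mult_add_rdistrib U matrix_vector_mult_scaleR
        flip: matrix_vector_mul_assoc)
  \<comment> \<open>Removing the component of \<open>y\<close> along \<open>u\<close> leaves
    \<open>M *v y\<close> unchanged and kills the rank-one term.\<close>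
  have "M *v y = ?N *v (y - ((u \<bullet> y) / (u \<bullet> u)) *\<^sub>R u)" for y
    using False unfolding N
    by (simp add: matrix_vector_mult_diff_distrib matrix_vector_mult_scaleR u inner_diff_right)
  then have "range ((*v) M) \<subseteq> range ((*v) ?N)"
    by blast
  then have "range ((*v) M) = range ((*v) ?N)"
    using rkN unfolding rank_dim_range
    by (intro subspace_dim_equal linear_subspace_image matrix_vector_mul_linear subspace_UNIV)
  moreover have "V *v u = ?N *v ((1 / (u \<bullet> u)) *\<^sub>R u)"
    using False unfolding N by (simp add: matrix_vector_mult_scaleR u)
  ultimately show ?thesis by (metis rangeI)
qed

text \<open>Let \<open>G\<close> be a right inverse of \<open>M\<close> on its range. Then
  \<open>x\<close> is \<open>G *v (M *v x)\<close> plus a kernel vector \<open>u\<close>; the first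
  part contributes \<open>V ** G ** M\<close>, and \<open>V *v u\<close> equals
  \<open>M *v (G *v (V *v u))\<close>.\<close>

lemma maps_kernel_into_range_imp_sum_products:
  fixes M V :: "real^'n^'n"
  assumes ker: "\<And>u. M *v u = 0 \<Longrightarrow> V *v u \<in> range ((*v) M)"
  shows "\<exists>Y Z. V = Y ** M + M ** Z"
proof -
  obtain g where g: "linear g" "\<And>v. v \<in> range ((*v) M) \<Longrightarrow> M *v g v = v"
    using linear_exists_right_inverse_on[OF matrix_vector_mul_linear[of M] subspace_UNIV] by auto
  define G where "G = matrix g"
  have G: "M *v (G *v v) = v" if "v \<in> range ((*v) M)" for v
    using g that by (simp add: G_def matrix_works)
  have "V *v x = (V ** G ** M + M ** (G ** V ** (mat 1 - G ** M))) *v x" for x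
  proof -
    let ?u = "x - G *v (M *v x)"
    have "M *v ?u = 0"
      using G by (simp add: matrix_vector_mult_diff_distrib)
    then have "M *v (G *v (V *v ?u)) = V *v ?u"
      by (intro G ker)
    then show ?thesis
      by (simp add: matrix_vector_mult_add_rdistrib matrix_vector_mult_diff_rdistrib
          matrix_vector_mult_diff_distrib flip: matrix_vector_mul_assoc)
  qed
  then show ?thesis
    unfolding matrix_eq by blast
qed

lemma closed_rank_le: "closed {A :: real^'n^'m. rank A \<le> r}"
  unfolding closed_sequential_limits
proof clarify
  fix x and l :: "real^'n^'m"
  assume "\<forall>n. x n \<in> {A. rank A \<le> r}" "x \<longlonglongrightarrow> l"
  then show "rank l \<le> r"
    using eventually_happens'[OF sequentially_bot rank_lower_semicontinuous[of x l]]
    by (auto intro: order_trans)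
qed

text \<open>A minimizer exists over the closed set of matrices of rank at most \<open>r\<close>. It
  lies within \<open>2 * dist X M\<close> of \<open>M\<close>, so for \<open>X\<close> close to
  \<open>M\<close> semicontinuity forces its rank to be exactly \<open>r\<close>. The choice in
  \<open>closest_point\<close> is then a genuine nearest point.\<close>

lemma proj_fixed_rank_near:
  fixes M :: "real^'n^'n"
  assumes "rank M = r"
  obtains e where "e > 0"
    and "\<And>X. dist X M < e \<Longrightarrow> rank (proj_fixed_rank r X) = r"
    and "\<And>X A. dist X M < e \<Longrightarrow> rank A = r \<Longrightarrow> dist X (proj_fixed_rank r X) \<le> dist X A"
proof -
  have "\<forall>\<^sub>F X in nhds M. r \<le> rank X"
    using rank_lower_semicontinuous[of "\<lambda>X. X" M "nhds M"] assms filterlim_ident by auto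
  then obtain d where d: "d > 0" "\<And>X. dist X M < d \<Longrightarrow> r \<le> rank X"
    unfolding eventually_nhds_metric by blast
  have *: "proj_fixed_rank r X \<in> fixed_rank_set r \<and>
      (\<forall>A\<in>fixed_rank_set r. dist X (proj_fixed_rank r X) \<le> dist X A)"
    if X: "dist X M < d / 2" for X
  proof -
    have "{A :: real^'n^'n. rank A \<le> r} \<noteq> {}"
      using assms by blast
    then obtain p where p: "rank p \<le> r" "\<And>A. rank A \<le> r \<Longrightarrow> dist X p \<le> dist X A"
      using distance_attains_inf[OF closed_rank_le[of r], of X] by auto
    have "dist p M \<le> dist X p + dist X M"
      by (rule dist_triangle3)
    also have "\<dots> \<le> dist X M + dist X M"
      using p(2)[of M] assms by simp
    also have "\<dots> < d"
      using X by simp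
    finally have "r \<le> rank p"
      by (rule d(2))
    then have "\<exists>p. p \<in> fixed_rank_set r \<and> (\<forall>A\<in>fixed_rank_set r. dist X p \<le> dist X A)"
      using p by (intro exI[of _ p]) (auto simp: fixed_rank_set_def)
    then show ?thesis
      unfolding proj_fixed_rank_def closest_point_def by (rule someI_ex)
  qed
  show ?thesis
  proof (rule that[of "d / 2"])
    show "d / 2 > 0"
      using d(1) by simp
  qed (use * in \<open>auto simp: fixed_rank_set_def\<close>)
qed

lemma alternating_projection_contracts:
  fixes M :: "real^'n^'n"
  assumes rank: "rank M = r"
    and trans: "tangent_space (completion_set M \<Omega>) M \<inter> tangent_space (fixed_rank_set r) M = {0}"
  shows "\<exists>c d. 0 < c \<and> c < 1 \<and> 0 < d \<and>
    (\<forall>X. dist X M < d \<longrightarrow>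
      norm (proj_completion M \<Omega> (proj_fixed_rank r X) - M) \<le> c * norm (X - M))"
proof (rule ccontr)
  assume neg: "\<not> ?thesis"
  \<comment> \<open>\<open>L\<close> is the linear part of \<open>proj_completion\<close>: the
    orthogonal projection onto the tangent space of the completion set.\<close>
  define L :: "real^'n^'n \<Rightarrow> real^'n^'n"
    where "L Z = (\<chi> i j. if (i, j) \<in> \<Omega> then 0 else Z $ i $ j)" for Z
  have L: "proj_completion M \<Omega> A - M = L (A - M)" for A
    by (simp add: proj_completion_nth L_def vec_eq_iff)
  have L_scale: "L (t *\<^sub>R Z) = t *\<^sub>R L Z" for t Z
    by (simp add: L_def vec_eq_iff)
  have "L Z \<bullet> (Z - L Z) = 0" for Z
    by (simp add: L_def inner_vec_def if_distrib sum.neutral)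
  then have L_pyth: "Z \<bullet> Z = L Z \<bullet> L Z + (Z - L Z) \<bullet> (Z - L Z)" for Z
    by (simp add: inner_diff_left inner_diff_right inner_commute)
  obtain e where e: "e > 0" "\<And>X. dist X M < e \<Longrightarrow> rank (proj_fixed_rank r X) = r"
    "\<And>X A. dist X M < e \<Longrightarrow> rank A = r \<Longrightarrow> dist X (proj_fixed_rank r X) \<le> dist X A"
    using proj_fixed_rank_near[OF rank] by blast
  \<comment> \<open>These factors increase to 1; the summand 2 makes \<open>c 0\<close> positive, so
    the negated claim supplies a counterexample for every \<open>k\<close>.\<close>
  define c where "c k = 1 - 1 / (real k + 2)" for k
  have "\<exists>X. dist X M < min e (1 / (real k + 1)) \<and>
      c k * norm (X - M) < norm (L (proj_fixed_rank r X - M))" for k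
  proof -
    have "0 < c k" "c k < 1" "0 < min e (1 / (real k + 1))"
      using e(1) by (auto simp: c_def)
    then show ?thesis
      using neg unfolding L not_le[symmetric] by blast
  qed
  then obtain X where X: "\<And>k. dist (X k) M < e" "\<And>k. dist (X k) M < 1 / (real k + 1)"
    "\<And>k. c k * norm (X k - M) < norm (L (proj_fixed_rank r (X k) - M))"
    unfolding min_less_iff_conj by metis
  define p where "p k = proj_fixed_rank r (X k)" for k
  define s where "s k = inverse (norm (X k - M))" for k
  define a where "a k = s k *\<^sub>R (X k - M)" for k
  define b where "b k = s k *\<^sub>R (p k - M)" for k
  have p: "rank (p k) = r" "dist (X k) (p k) \<le> dist (X k) M" for k
    using e X(1) rank by (auto simp: p_def)
  have pM: "dist (p k) M \<le> 2 * dist (X k) M" for k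
    using dist_triangle3[of "p k" M "X k"] p(2)[of k] by simp
  \<comment> \<open>If \<open>X k = M\<close>, then \<open>p k = M\<close> as well and the strict
    inequality for \<open>X k\<close> would read \<open>0 < 0\<close>.\<close>
  have "X k \<noteq> M" for k
    using X(3)[of k] pM[of k] L_scale[of 0 0] by (auto simp: p_def)
  then have sp: "norm (X k - M) > 0" "s k > 0" for k
    by (auto simp: s_def)
  have na: "norm (a k) = 1" for k
    using sp[of k] by (simp add: a_def s_def)
  have nb: "norm (b k) \<le> 2" for k
    using pM[of k] sp[of k] by (simp add: b_def s_def dist_norm divide_simps)
  have nLb: "c k < norm (L (b k))" for k
    using X(3)[of k] sp[of k] by (simp add: b_def s_def L_scale p_def divide_simps del: scaleR_right_diff_distrib)
  have X_lim: "X \<longlonglongrightarrow> M"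
  proof (rule metric_tendsto_imp_tendsto)
    show "(\<lambda>k. 1 / (real k + 1)) \<longlonglongrightarrow> 0"
      using LIMSEQ_inverse_real_of_nat by (simp add: inverse_eq_divide add.commute)
    show "\<forall>\<^sub>F k in sequentially. dist (X k) M \<le> dist (1 / (real k + 1)) 0"
      using X(2) by (simp add: less_imp_le)
  qed
  have p_lim: "p \<longlonglongrightarrow> M"
  proof (rule metric_tendsto_imp_tendsto)
    show "(\<lambda>k. 2 * dist (X k) M) \<longlonglongrightarrow> 0"
      using tendsto_mult_right_zero[OF tendsto_dist[OF X_lim tendsto_const[of M], simplified]] .
    show "\<forall>\<^sub>F k in sequentially. dist (p k) M \<le> dist (2 * dist (X k) M) 0"
      using pM by simp
  qed
  have c_lim: "c \<longlonglongrightarrow> 1"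
  proof -
    have "(\<lambda>k. inverse (real (Suc k))) \<longlonglongrightarrow> 0"
      by (rule LIMSEQ_inverse_real_of_nat)
    then have "(\<lambda>k. 1 - inverse (real (Suc (Suc k)))) \<longlonglongrightarrow> 1 - 0"
      by (intro tendsto_diff tendsto_const) (rule LIMSEQ_Suc)
    then show ?thesis
      by (simp add: c_def[abs_def] inverse_eq_divide add.commute)
  qed
  \<comment> \<open>Compactness is applied to pairs so that one subsequence serves both
    \<open>a\<close> and \<open>b\<close>.\<close>
  have "compact (cball (0::real^'n^'n) 1 \<times> cball (0::real^'n^'n) 2)"
    by (intro compact_Times compact_cball)
  moreover have "\<forall>k. (a k, b k) \<in> cball 0 1 \<times> cball 0 2"
    using na nb by simp
  ultimately obtain f l where f: "strict_mono (f :: nat \<Rightarrow> nat)"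
    "((\<lambda>k. (a k, b k)) \<circ> f) \<longlonglongrightarrow> l"
    unfolding compact_def by meson
  define a' b' where "a' = fst l" and "b' = snd l"
  have a_lim: "(\<lambda>k. a (f k)) \<longlonglongrightarrow> a'"
    using tendsto_fst[OF f(2)] by (simp add: a'_def o_def)
  have b_lim: "(\<lambda>k. b (f k)) \<longlonglongrightarrow> b'"
    using tendsto_snd[OF f(2)] by (simp add: b'_def o_def)
  have pf_lim: "(\<lambda>k. p (f k)) \<longlonglongrightarrow> M"
    using LIMSEQ_subseq_LIMSEQ[OF p_lim f(1)] by (simp add: o_def)
  have "norm a' = 1"
    using tendsto_norm[OF a_lim] by (simp add: na LIMSEQ_const_iff)
  have L_cont: "isCont L Z" for Z
  proof -
    have "linear L"
      by (rule linearI) (auto simp: L_def vec_eq_iff)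
    then show ?thesis
      by (rule linear_continuous_at[OF linear_conv_bounded_linear[THEN iffD1]])
  qed
  have "1 \<le> norm (L b')"
  proof (rule LIMSEQ_le)
    show "(\<lambda>k. c (f k)) \<longlonglongrightarrow> 1"
      using LIMSEQ_subseq_LIMSEQ[OF c_lim f(1)] by (simp add: o_def)
    show "(\<lambda>k. norm (L (b (f k)))) \<longlonglongrightarrow> norm (L b')"
      by (intro tendsto_norm isCont_tendsto_compose[OF L_cont] b_lim)
    show "\<exists>N. \<forall>n\<ge>N. c (f n) \<le> norm (L (b (f n)))"
      using nLb less_imp_le by blast
  qed
  have "b' *v u \<in> range ((*v) M)" if "M *v u = 0" for u
  proof (rule fixed_rank_limit_direction_kernel[OF _ sequentially_bot pf_lim _ that])
    show "\<forall>\<^sub>F k in sequentially. rank (p (f k)) = rank M"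
      using p(1) rank by simp
    show "(\<lambda>k. s (f k) *\<^sub>R (p (f k) - M)) \<longlonglongrightarrow> b'"
      using b_lim by (simp add: b_def)
  qed
  then obtain Y Z where YZ: "b' = Y ** M + M ** Z"
    using maps_kernel_into_range_imp_sum_products by blast
  \<comment> \<open>The tangent space moves with \<open>p k\<close>. Keeping \<open>Y\<close> and
    \<open>Z\<close> fixed gives a tangent vector at each \<open>p k\<close>, and these converge to
    \<open>b'\<close>, so orthogonality passes to the limit.\<close>
  have "(a k - b k) \<bullet> (Y ** p k + p k ** Z) = 0" for k
  proof -
    have "Y ** p k + p k ** Z \<in> tangent_space (fixed_rank_set r) (p k)"
      unfolding tangent_space_fixed_rank_set[OF p(1)] by blast
    then have "(X k - p k) \<bullet> (Y ** p k + p k ** Z) = 0"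
      using e(3) X(1) by (intro nearest_orthogonal_tangent) (auto simp: fixed_rank_set_def p_def)
    moreover have "a k - b k = s k *\<^sub>R (X k - p k)"
      by (simp add: a_def b_def algebra_simps)
    ultimately show ?thesis by simp
  qed
  moreover have "(\<lambda>k. (a (f k) - b (f k)) \<bullet> (Y ** p (f k) + p (f k) ** Z))
      \<longlonglongrightarrow> (a' - b') \<bullet> (Y ** M + M ** Z)"
    unfolding matrix_matrix_mult_def
    by (intro tendsto_inner tendsto_diff a_lim b_lim tendsto_add vec_tendstoI)
      (auto intro!: tendsto_intros pf_lim)
  ultimately have "(a' - b') \<bullet> b' = 0"
    unfolding YZ by (simp add: LIMSEQ_const_iff)
  then have "a' \<bullet> a' = b' \<bullet> b' + (a' - b') \<bullet> (a' - b')"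
    by (simp add: inner_diff_left inner_diff_right inner_commute)
  then have "b' \<bullet> b' \<le> 1"
    using \<open>norm a' = 1\<close>[unfolded norm_eq_1] inner_ge_zero[of "a' - b'"] by linarith
  moreover have "1 \<le> L b' \<bullet> L b'"
    using \<open>1 \<le> norm (L b')\<close> by (simp flip: power2_norm_eq_inner)
  \<comment> \<open>By Pythagoras for \<open>L\<close>, the squared norm of \<open>b' - L b'\<close>
    is that of \<open>b'\<close>, at most 1, minus that of \<open>L b'\<close>, at least 1.\<close>
  ultimately have "(b' - L b') \<bullet> (b' - L b') \<le> 0"
    using L_pyth[of b'] by linarith
  then have Lb: "b' = L b'"
    by (metis inner_eq_zero_iff inner_ge_zero order_antisym right_minus_eq)
  have "b' $ i $ j = 0" if "(i, j) \<in> \<Omega>" for i j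
    using that by (subst Lb) (simp add: L_def)
  then have "b' \<in> tangent_space (completion_set M \<Omega>) M"
    unfolding tangent_space_completion_set by auto
  moreover have "b' \<in> tangent_space (fixed_rank_set r) M"
    unfolding tangent_space_fixed_rank_set[OF rank] using YZ by blast
  ultimately have "b' = 0"
    using trans by blast
  then show False
    using Lb \<open>1 \<le> norm (L b')\<close> by simp
qed

theorem theorem2:
  fixes M :: "real^'n^'n" and r :: nat and \<Omega> :: "('n \<times> 'n) set"
  assumes "rank M = r"
    and "tangent_space (completion_set M \<Omega>) M \<inter> tangent_space (fixed_rank_set r) M = {0}"
  shows "\<exists>V. open V \<and> M \<in> V \<and>
    (\<forall>X :: nat \<Rightarrow> real^'n^'n.
       X 0 \<in> V \<longrightarrow>
       (\<forall>k. X (Suc k) = proj_completion M \<Omega> (proj_fixed_rank r (X k))) \<longrightarrow>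
       (\<exists>c. 0 < c \<and> c < 1 \<and> (\<forall>k. norm (X k - M) \<le> c ^ k * norm (X 0 - M))))"
proof -
  obtain c d where c: "0 < c" "c < 1" and d: "0 < d"
    and contr: "\<And>X. dist X M < d \<Longrightarrow>
      norm (proj_completion M \<Omega> (proj_fixed_rank r X) - M) \<le> c * norm (X - M)"
    using alternating_projection_contracts[OF assms] by blast
  show ?thesis
  proof (intro exI[of _ "ball M d"] conjI allI impI)
    show "open (ball M d)" "M \<in> ball M d"
      using d by auto
  next
    fix X :: "nat \<Rightarrow> real^'n^'n"
    assume X0: "X 0 \<in> ball M d"
      and step: "\<forall>k. X (Suc k) = proj_completion M \<Omega> (proj_fixed_rank r (X k))"
    have "norm (X k - M) \<le> c ^ k * norm (X 0 - M)" for k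
    proof (induction k)
      case (Suc k)
      \<comment> \<open>The induction hypothesis and \<open>c ^ k \<le> 1\<close> keep
        \<open>X k\<close> in the ball where the contraction holds.\<close>
      have "c ^ k * norm (X 0 - M) \<le> norm (X 0 - M)"
        using c by (intro mult_left_le_one_le power_le_one) auto
      also have "\<dots> < d"
        using X0 by (simp add: dist_norm norm_minus_commute)
      finally have "norm (X (Suc k) - M) \<le> c * norm (X k - M)"
        using Suc.IH step contr[of "X k"] by (simp add: dist_norm)
      also have "\<dots> \<le> c * (c ^ k * norm (X 0 - M))"
        using Suc.IH c(1) by (intro mult_left_mono) auto
      finally show ?case by (simp add: mult.assoc)
    qed simp
    then show "\<exists>c. 0 < c \<and> c < 1 \<and> (\<forall>k. norm (X k - M) \<le> c ^ k * norm (X 0 - M))"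
      using c by blast
  qed
qed

end
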